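(* Let $n\equiv 1\pmod{4}$ be a positive integer and let $a,b,c$ be indeterminates. Then \[ \sum_{k=0}^{(n+1)/2} \frac{(1+aq^{4k-1})\, (a^2/q^2, b/q^2, c/q^2;q^4)_k } {(1+aq^{-1})\, (a^2q^4/b, a^2q^4/c, q^4;q^4)_k } \left(\frac{aq^7}{bc}\right)^k \equiv 0\pmod{(1-a^2q^{2n})}; \] in particular, if moreover $n>1$, \[ \sum_{k=0}^{(n+1)/2} \frac{(1+q^{4k-1})\, (q^{-2};q^4)_k^3}{(1+q)\,(q^4;q^4)_k^3}\, q^{7k} \equiv 0\pmod{\Phi_n(q)\Phi_n(-q)}. \]
   Context: Here $q,a,b,c$ are indeterminates. For $x$ and a base $p$ (a power of $q$), $(x;p)_k=\prod_{j=0}^{k-1}(1-xp^j)$ and $(x_1,\dots,x_m;p)_k=(x_1;p)_k\cdots(x_m;p)_k$. $\Phi_n(q)$ is the $n$-th cyclotomic polynomial. For rational functions $A,B$ in these variables and a polynomial $P$, $A\equiv B\pmod{P}$ means that the numerator of the reduced form of $A-B$ is divisible by $P$ in the polynomial ring over $\mathbb{Z}$ in these variables. *)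

theory Defs
  imports
    Complex_Main
    "HOL-Computational_Algebra.Computational_Algebra"
    "HOL-Number_Theory.Cong"
begin

definition q_pochhammer :: "'a :: comm_ring_1 \<Rightarrow> 'a \<Rightarrow> nat \<Rightarrow> 'a" where
  "q_pochhammer x p k = (\<Prod>j<k. 1 - x * p ^ j)"

text \<open>
  Rational functions are elements of the field of fractions of a polynomial ring \<open>'a\<close>.
  The function \<^const>\<open>quot_of_fract\<close> returns the coprime numerator and denominator of such an
  element, so the first component is the numerator of the reduced form.
\<close>

definition ratfun_cong ::
  "'a :: {ring_gcd, idom_divide, semiring_gcd_mult_normalize} fract \<Rightarrow> 'a fract \<Rightarrow> 'a \<Rightarrow> bool" where
  "ratfun_cong A B P \<longleftrightarrow> P dvd fst (quot_of_fract (A - B))"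

text \<open>
  The polynomial ring over the integers in the indeterminates \<open>q\<close>, \<open>a\<close>, \<open>b\<close>, \<open>c\<close> is represented
  as the iterated polynomial ring \<open>\<int>[q][a][b][c]\<close>; \<open>q\<close> is the innermost indeterminate.
\<close>

type_synonym poly4 = "int poly poly poly poly"

definition poly_q :: poly4 where "poly_q = [:[:[:[:0, 1:]:]:]:]"
definition poly_a :: poly4 where "poly_a = [:[:[:0, 1:]:]:]"
definition poly_b :: poly4 where "poly_b = [:[:0, 1:]:]"
definition poly_c :: poly4 where "poly_c = [:0, 1:]"

text \<open>
  The cyclotomic polynomial is the integer polynomial whose image over the complex numbers is the
  product of \<open>X - \<zeta>\<close> over the primitive \<open>n\<close>-th roots of unity \<open>\<zeta>\<close>. That such a polynomial
  exists (and is unique) is the lemma \<open>of_int_cyclotomic_poly\<close> below.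
\<close>

definition complex_cyclotomic_poly :: "nat \<Rightarrow> complex poly" where
  "complex_cyclotomic_poly n =
     (\<Prod>k\<in>{k\<in>{1..n}. coprime k n}. [:- cis (2 * pi * real k / real n), 1:])"

definition cyclotomic_poly :: "nat \<Rightarrow> int poly" where
  "cyclotomic_poly n = (THE p. map_poly of_int p = complex_cyclotomic_poly n)"

lemma monic_complex_cyclotomic_poly: "lead_coeff (complex_cyclotomic_poly n) = 1"
  unfolding complex_cyclotomic_poly_def by (simp add: lead_coeff_prod)

lemma prod_complex_cyclotomic_poly:
  assumes "n > 0"
  shows "(\<Prod>d\<in>{d. d dvd n}. complex_cyclotomic_poly d) = monom 1 n - 1"
proof -
  define f :: "nat \<Rightarrow> complex" where "f k = cis (2 * pi * real k / real n)" for k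
  define S where "S = (SIGMA d:{d. d dvd n}. {k\<in>{1..d}. coprime k d})"
  have fin: "finite {d. d dvd n}" using assms by (simp add: finite_divisors_nat)
  have bij: "bij_betw (\<lambda>(d,k). k * (n div d)) S {1..n}"
  proof (rule bij_betwI[where g = "\<lambda>k. (n div gcd k n, k div gcd k n)"])
    show "(\<lambda>(d,k). k * (n div d)) \<in> S \<rightarrow> {1..n}"
    proof
      fix x assume "x \<in> S"
      then obtain d k where x: "x = (d, k)" "d dvd n" "1 \<le> k" "k \<le> d" by (auto simp: S_def)
      then obtain e where e: "n = d * e" by blast
      with assms have "d > 0" "e > 0" by auto
      with x e show "(case x of (d, k) \<Rightarrow> k * (n div d)) \<in> {1..n}" by simp
    qed
    show "(\<lambda>k. (n div gcd k n, k div gcd k n)) \<in> {1..n} \<rightarrow> S"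
    proof
      fix k assume k: "k \<in> {1..n}"
      have "coprime (k div gcd k n) (n div gcd k n)"
        using assms by (intro div_gcd_coprime) auto
      moreover have "1 \<le> k div gcd k n"
        using k by (simp add: Suc_le_eq div_greater_zero_iff)
      moreover have "k div gcd k n \<le> n div gcd k n"
        using k by (intro div_le_mono) auto
      moreover have "n div gcd k n dvd n"
        by (metis dvd_div_mult_self dvd_triv_left gcd_dvd2)
      ultimately show "(n div gcd k n, k div gcd k n) \<in> S"
        by (auto simp: S_def)
    qed
  next
    fix x assume "x \<in> S"
    then obtain d k where x: "x = (d, k)" "d dvd n" "coprime k d" "1 \<le> k"
      by (auto simp: S_def)
    then obtain e where e: "n = d * e" by blast
    with assms have "d > 0" "e > 0" by auto
    have g: "gcd (k * e) (d * e) = e" using x(3) by (simp add: gcd_mult_right coprime_iff_gcd_eq_1 gcd.commute)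
    show "(case case x of (d, k) \<Rightarrow> k * (n div d) of
             k \<Rightarrow> (n div gcd k n, k div gcd k n)) = x"
      using \<open>d > 0\<close> \<open>e > 0\<close> by (simp add: x(1) e g)
  next
    fix k assume k: "k \<in> {1..n}"
    define g where "g = gcd k n"
    have "g dvd n" "g dvd k" "g > 0" using assms by (auto simp: g_def)
    then obtain e l where el: "n = g * e" "k = g * l" by blast
    with assms \<open>g > 0\<close> have "e > 0" by auto
    have "k div g * (n div (n div g)) = k" using \<open>g > 0\<close> \<open>e > 0\<close> by (simp add: el)
    then show "(case (n div gcd k n, k div gcd k n) of (d, k) \<Rightarrow> k * (n div d)) = k"
      by (simp only: g_def prod.case)
  qed
  have "(\<Prod>d\<in>{d. d dvd n}. complex_cyclotomic_poly d) =
        (\<Prod>(d,k)\<in>S. [:- cis (2 * pi * real k / real d), 1:])"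
    unfolding complex_cyclotomic_poly_def S_def by (subst prod.Sigma) (use fin in auto)
  also have "\<dots> = (\<Prod>x\<in>S. [:- f (case x of (d,k) \<Rightarrow> k * (n div d)), 1:])"
  proof (rule prod.cong[OF refl])
    fix x assume "x \<in> S"
    then obtain d k where x: "x = (d, k)" "d dvd n" by (auto simp: S_def)
    then obtain e where e: "n = d * e" by blast
    with assms have "d > 0" "e > 0" by auto
    then show "(case x of (d, k) \<Rightarrow> [:- cis (2 * pi * real k / real d), 1:]) =
          [:- f (case x of (d,k) \<Rightarrow> k * (n div d)), 1:]"
      by (simp add: x(1) f_def e mult.assoc)
  qed
  also have "\<dots> = (\<Prod>k\<in>{1..n}. [:- f k, 1:])"
    by (rule prod.reindex_bij_betw[OF bij])
  also have "\<dots> = (\<Prod>k<n. [:- f k, 1:])"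
  proof -
    have "f n = f 0" using assms by (simp add: f_def)
    have "{1..n} = insert n {1..<n}" "{..<n} = insert 0 {1..<n}" using assms by auto
    with \<open>f n = f 0\<close> show ?thesis by simp
  qed
  also have "\<dots> = (\<Prod>z\<in>{z::complex. z ^ n = 1}. [:- z, 1:])"
    unfolding f_def using prod.reindex_bij_betw[OF bij_betw_roots_unity[OF assms]] .
  also have "\<dots> = monom 1 n - 1"
  proof -
    let ?R = "{z::complex. z ^ n = 1}"
    let ?P = "\<Prod>z\<in>?R. [:- z, 1:]"
    let ?Q = "monom 1 n - 1 :: complex poly"
    have finR: "finite ?R" using assms finite_roots_unity[of n] by simp
    have cardR: "card ?R = n" using assms by (rule card_roots_unity_eq)
    have degP: "degree ?P = n"
      using finR cardR by (subst degree_prod_eq_sum_degree) auto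
    have "lead_coeff ?P = 1" by (simp add: lead_coeff_prod)
    with degP have "coeff ?P n = coeff ?Q n" using assms by simp
    moreover have "degree ?Q \<le> n" by (intro degree_diff_le) (auto simp: degree_monom_le)
    moreover have "poly ?P z = poly ?Q z" if "z \<in> ?R" for z
      using that finR by (auto simp: poly_prod poly_monom)
    ultimately show ?thesis
      using degP cardR by (intro poly_eqI_degree_lead_coeff[where A = ?R and n = n]) auto
  qed
  finally show ?thesis .
qed

lemma complex_cyclotomic_poly_integral:
  "\<exists>p :: int poly. map_poly of_int p = complex_cyclotomic_poly n"
proof (induction n rule: less_induct)
  case (less n)
  show ?case
  proof (cases "n = 0")
    case True
    then show ?thesis by (intro exI[of _ 1]) (simp add: complex_cyclotomic_poly_def)
  next
    case False
    define I where "I = {d. d dvd n \<and> d \<noteq> n}"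
    have finI: "finite I" using False by (auto simp: I_def)
    have "\<forall>d\<in>I. \<exists>p :: int poly. map_poly of_int p = complex_cyclotomic_poly d"
      using False by (auto simp: I_def intro!: less.IH dest: dvd_imp_le)
    then obtain F :: "nat \<Rightarrow> int poly"
      where F: "\<And>d. d \<in> I \<Longrightarrow> map_poly of_int (F d) = complex_cyclotomic_poly d" by metis
    let ?h = "map_poly of_int :: int poly \<Rightarrow> complex poly"
    have h_mult: "?h (p * r) = ?h p * ?h r" for p r
      by (rule poly_eqI) (simp add: coeff_map_poly coeff_mult)
    have h_add: "?h (p + r) = ?h p + ?h r" for p r
      by (rule poly_eqI) (simp add: coeff_map_poly)
    have h_prod: "?h (\<Prod>d\<in>J. F d) = (\<Prod>d\<in>J. ?h (F d))" for J
      by (induction J rule: infinite_finite_induct) (simp_all add: h_mult)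
    have deg: "degree (?h p) = degree p" for p by (rule degree_map_poly) simp
    define G where "G = (\<Prod>d\<in>I. F d)"
    define C where "C = complex_cyclotomic_poly n"
    have hG: "?h G = (\<Prod>d\<in>I. complex_cyclotomic_poly d)"
      unfolding G_def by (simp add: h_prod F)
    have lcG: "lead_coeff G = 1"
    proof -
      have "of_int (lead_coeff G) = lead_coeff (?h G)" by (simp add: deg coeff_map_poly)
      also have "\<dots> = (1 :: complex)"
        by (simp add: hG lead_coeff_prod monic_complex_cyclotomic_poly)
      finally show ?thesis by simp
    qed
    then have "G \<noteq> 0" by auto
    have "{d. d dvd n} = insert n I" "n \<notin> I" by (auto simp: I_def)
    then have split: "C * ?h G = monom 1 n - 1"
      using prod_complex_cyclotomic_poly[of n] False finI by (simp add: hG C_def)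
    obtain Q R where QR: "pseudo_divmod (monom 1 n - 1) G = (Q, R)" by fastforce
    from pseudo_divmod[OF \<open>G \<noteq> 0\<close> QR] lcG
    have eq: "monom 1 n - 1 = G * Q + R" and R: "R = 0 \<or> degree R < degree G" by auto
    have "?h (monom 1 n - 1) = monom 1 n - 1"
      by (rule poly_eqI) (simp add: coeff_map_poly)
    then have "C * ?h G = ?h G * ?h Q + ?h R"
      using split by (simp add: eq h_add h_mult)
    then have hR: "?h R = ?h G * (C - ?h Q)" by (simp add: algebra_simps)
    have "?h G \<noteq> 0" using hG monic_complex_cyclotomic_poly
      by (metis finI leading_coeff_0_iff prod_zero_iff zero_neq_one)
    have "C - ?h Q = 0"
    proof (rule ccontr)
      assume *: "C - ?h Q \<noteq> 0"
      with \<open>?h G \<noteq> 0\<close> hR have "degree R = degree G + degree (C - ?h Q)"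
        by (metis deg degree_mult_eq)
      moreover have "R \<noteq> 0" using * \<open>?h G \<noteq> 0\<close> hR by auto
      ultimately show False using R by simp
    qed
    then show ?thesis unfolding C_def by (intro exI[of _ Q]) simp
  qed
qed

lemma of_int_cyclotomic_poly:
  "map_poly of_int (cyclotomic_poly n) = complex_cyclotomic_poly n"
  unfolding cyclotomic_poly_def
proof (rule theI')
  have "p = r" if "map_poly of_int p = (map_poly of_int r :: complex poly)" for p r :: "int poly"
  proof (rule poly_eqI)
    fix i
    have "coeff (map_poly of_int p) i = coeff (map_poly of_int r :: complex poly) i"
      by (simp only: that)
    then show "coeff p i = coeff r i" by (simp add: coeff_map_poly)
  qed
  then show "\<exists>!p :: int poly. map_poly of_int p = complex_cyclotomic_poly n"
    using complex_cyclotomic_poly_integral[of n] by metis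
qed

end

theory Submission
  imports Defs
begin

text \<open>
  Put \<open>N = (n + 1) / 2\<close>, which is odd. If \<open>a\<^sup>2 q\<^bsup>2n\<^esup> = 1\<close>, then \<open>a\<^sup>2 / q\<^sup>2 = (q\<^sup>4)\<^bsup>-N\<^esup>\<close>, so the
  well-poised sum ends at \<open>k = N\<close>, and reversing the order of summation changes the sign of
  every summand. Hence the sum vanishes in any field where \<open>a\<^sup>2 q\<^bsup>2n\<^esup> = 1\<close> and the denominators
  are nonzero. The first congruence follows by specializing \<open>a\<close> to \<open>\<plusminus>q\<^bsup>-n\<^esup>\<close>. For the second,
  take \<open>a = b = c = 1\<close> and let \<open>q\<close> be plus or minus a primitive \<open>n\<close>-th root of unity: these are
  the roots, all simple, of the modulus.
\<close>

section \<open>q-shifted factorials and the vanishing of the terminating well-poised sum\<close>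

lemma q_pochhammer_0 [simp]: "q_pochhammer x p 0 = 1"
  by (simp add: q_pochhammer_def)

lemma q_pochhammer_Suc [simp]: "q_pochhammer x p (Suc k) = q_pochhammer x p k * (1 - x * p ^ k)"
  by (simp add: q_pochhammer_def)

lemma q_pochhammer_neq_0_mono:
  fixes x p :: "'a :: idom"
  assumes "q_pochhammer x p m \<noteq> 0" "k \<le> m"
  shows "q_pochhammer x p k \<noteq> 0"
  using assms by (auto simp: q_pochhammer_def)

text \<open>Since \<open>D = p^(1-k-l) / B\<close>, each of the last \<open>k\<close> factors on the
  left turns around: \<open>1 - B p^(l+i) = - B p^(l+i) (1 - D p^(k-1-i))\<close> for
  \<open>i < k\<close>. The exponents \<open>l + i\<close> add up to
  \<open>k * l + \<Sum>{..<k}\<close>. The induction moves one factor across at a time.\<close>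

lemma q_pochhammer_reverse:
  fixes B D p :: "'a :: field"
  assumes "p \<noteq> 0" "B * D * p ^ (k + l) = p"
  shows "q_pochhammer B p (k + l) =
           q_pochhammer B p l * q_pochhammer D p k * (- B) ^ k * p ^ (k * l + \<Sum>{..<k})"
  using assms(2)
proof (induction k arbitrary: l)
  case 0
  then show ?case by simp
next
  case (Suc k)
  have "p * (B * D * p ^ (k + l)) = p * 1"
    using Suc.prems by (simp add: algebra_simps)
  then have "B * D * p ^ (k + l) = 1"
    using assms(1) by (metis mult_left_cancel)
  then have step: "1 - B * p ^ l = - B * p ^ l * (1 - D * p ^ k)"
    by (simp add: algebra_simps power_add)
  have "q_pochhammer B p (k + Suc l) =
      q_pochhammer B p (Suc l) * q_pochhammer D p k * (- B) ^ k * p ^ (k * Suc l + \<Sum>{..<k})"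
    by (rule Suc.IH) (use Suc.prems in simp)
  also have "\<dots> = q_pochhammer B p l * q_pochhammer D p (Suc k) * (- B) ^ Suc k
                  * p ^ (Suc k * l + \<Sum>{..<Suc k})"
    by (simp only: q_pochhammer_Suc step lessThan_Suc sum.insert finite_lessThan)
       (simp add: power_add algebra_simps)
  finally show ?case by simp
qed

text \<open>\<open>w\<close> is the part of the \<open>k\<close>-th summand of the series that is
  not symmetric in \<open>k\<close> and \<open>l = N - k\<close>. Three reversals in base
  \<open>q^4\<close> contribute \<open>(q^4)^3 = q^12\<close> and the factors
  \<open>- a^2/q^2\<close>, \<open>- b/q^2\<close>, \<open>- c/q^2\<close>, whose product with
  \<open>a q^7 / (b c)\<close> is \<open>- a^3 q\<close>. Put \<open>e = a q^(2N-1)\<close>, so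
  \<open>e^2 = 1\<close>. Exchanging \<open>k\<close> and \<open>l\<close> multiplies the bracket
  found below by \<open>e\<close> and the power of \<open>- e\<close> by \<open>- e\<close>, in
  total by \<open>- e^2 = -1\<close>.\<close>

lemma well_poised_weight_antisym:
  fixes q a :: "'a :: field"
  assumes "q \<noteq> 0" "a\<^sup>2 * q powi (4 * int (k + l) - 2) = 1" "odd (k + l)"
  defines "w \<equiv> \<lambda>k l. (1 + a * q powi (4 * int k - 1)) * (- (a ^ 3 * q)) ^ k
                        * (q ^ 12) ^ (k * l + \<Sum>{..<k})"
  shows "w l k = - w k l"
proof -
  define e where "e = a * q powi (2 * int (k + l) - 1)"
  have e2: "e\<^sup>2 = 1"
  proof -
    have "e\<^sup>2 = a\<^sup>2 * q powi ((2 * int (k + l) - 1) * int 2)"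
      by (simp only: e_def power_mult_distrib power_int_power')
    then show ?thesis using assms(2) by (simp add: algebra_simps)
  qed
  have a: "a = e * q powi (1 - 2 * int (k + l))"
    using assms(1) by (simp add: e_def mult.assoc flip: power_int_add)
  \<comment> \<open>Eliminating \<open>a\<close> in favour of \<open>e\<close> leaves a bracket
    whose two exponents trade places when \<open>i\<close> and \<open>j\<close> are
    exchanged.\<close>
  have w: "w i j = (- e) ^ i * (q powi (6 * int i * int j - 2 * int i)
                       + e * q powi (6 * int i * int j - 2 * int j))"
    if ij: "i + j = k + l" for i j
  proof -
    have a': "a = e * q powi (1 - 2 * int (i + j))" using a ij by simp
    have "a * q powi (4 * int i - 1) = e * (q powi (1 - 2 * int (i + j)) * q powi (4 * int i - 1))"
      using a' by (simp add: mult.assoc)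
    also have "\<dots> = e * q powi (2 * int i - 2 * int j)"
      using assms(1) by (simp add: algebra_simps flip: power_int_add)
    finally have 1: "a * q powi (4 * int i - 1) = e * q powi (2 * int i - 2 * int j)" .
    have "e ^ 3 = e" using e2 by (simp add: power3_eq_cube power2_eq_square)
    then have "a ^ 3 * q = e * (q powi ((1 - 2 * int (i + j)) * int 3) * q powi 1)"
      by (simp only: a' power_mult_distrib power_int_power' power_int_1_right mult.assoc)
    also have "\<dots> = e * q powi (4 - 6 * int (i + j))"
      using assms(1) by (subst power_int_add [symmetric]) (auto simp: algebra_simps)
    finally have "(- (a ^ 3 * q)) ^ i = (- e * q powi (4 - 6 * int (i + j))) ^ i" by simp
    also have "\<dots> = (- e) ^ i * q powi ((4 - 6 * int (i + j)) * int i)"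
      by (simp only: power_mult_distrib power_int_power')
    finally have 2: "(- (a ^ 3 * q)) ^ i = (- e) ^ i * q powi ((4 - 6 * int (i + j)) * int i)" .
    have "2 * int (\<Sum>{..<i}) = int i * (int i - 1)"
      by (induction i) (auto simp: algebra_simps)
    then have "int (12 * (i * j + \<Sum>{..<i})) = 12 * int i * int j + 6 * int i * (int i - 1)"
      by (simp add: algebra_simps)
    then have 3: "(q ^ 12) ^ (i * j + \<Sum>{..<i}) = q powi (12 * int i * int j + 6 * int i * (int i - 1))"
      by (metis power_int_of_nat power_mult)
    have "w i j = (1 + e * q powi (2 * int i - 2 * int j)) * (- e) ^ i *
       (q powi ((4 - 6 * int (i + j)) * int i) * q powi (12 * int i * int j + 6 * int i * (int i - 1)))"
      unfolding w_def 1 2 3 by (simp add: algebra_simps)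
    also have "q powi ((4 - 6 * int (i + j)) * int i) * q powi (12 * int i * int j + 6 * int i * (int i - 1))
       = q powi (6 * int i * int j - 2 * int i)"
      using assms(1) by (subst power_int_add [symmetric]) (auto simp: algebra_simps)
    also have "(1 + e * q powi (2 * int i - 2 * int j)) * (- e) ^ i * q powi (6 * int i * int j - 2 * int i)
       = (- e) ^ i * (q powi (6 * int i * int j - 2 * int i)
          + e * (q powi (2 * int i - 2 * int j) * q powi (6 * int i * int j - 2 * int i)))"
      by (simp add: algebra_simps)
    also have "q powi (2 * int i - 2 * int j) * q powi (6 * int i * int j - 2 * int i)
       = q powi (6 * int i * int j - 2 * int j)"
      using assms(1) by (subst power_int_add [symmetric]) (auto simp: algebra_simps)
    finally show ?thesis .
  qed
  \<comment> \<open>\<open>Suc l\<close> and \<open>k\<close> have the same parity because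
    \<open>k + l\<close> is odd, and \<open>(- e)^2 = 1\<close>.\<close>
  have "(- e) ^ Suc l = (- e) ^ k"
  proof (cases "even k")
    case True
    then have "even (Suc l)" using assms(3) by simp
    then obtain j where "Suc l = 2 * j" by (rule evenE)
    moreover obtain i where "k = 2 * i" using True by (rule evenE)
    ultimately show ?thesis using e2 by (simp only: power_mult power2_minus power_one)
  next
    case False
    then have "even l" using assms(3) by simp
    then obtain j where "l = 2 * j" by (rule evenE)
    moreover obtain i where "k = Suc (2 * i)" using False by (auto elim: oddE)
    ultimately show ?thesis using e2 by (simp only: power_Suc power_mult power2_minus power_one)
  qed
  then have el: "(- e) ^ k = - e * (- e) ^ l" by simp
  have *: "w l k = (- e) ^ l * (q powi (6 * int k * int l - 2 * int l)
                       + e * q powi (6 * int k * int l - 2 * int k))"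
    using w[of l k] by (simp add: ac_simps)
  have ee: "e * e = 1" using e2 by (simp add: power2_eq_square)
  then have "e * (e * x) = x" for x by (simp flip: mult.assoc)
  with ee show ?thesis
    unfolding * w[of k l, OF refl] el by (simp add: distrib_left distrib_right mult_ac)
qed

text \<open>Pair \<open>k\<close> with \<open>N - k\<close>. For odd \<open>N\<close> no index is
  its own partner, so the lower and upper halves cancel outright, without a division by 2.\<close>

lemma sum_antisym_eq_0:
  fixes f :: "nat \<Rightarrow> 'a :: ab_group_add"
  assumes "odd N" "\<And>k l. k + l = N \<Longrightarrow> f l = - f k"
  shows "(\<Sum>k = 0..N. f k) = 0"
proof -
  obtain m where N: "N = 2 * m + 1" using assms(1) by (elim oddE)
  have "(\<Sum>k = 0..N. f k) = (\<Sum>k = 0..m. f k) + (\<Sum>k = Suc m..N. f k)"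
    using sum.ub_add_nat[of 0 m f "m + 1"] by (simp add: N mult_2)
  also have "(\<Sum>k = Suc m..N. f k) = (\<Sum>k = 0..m. f (N - k))"
    by (rule sum.reindex_bij_witness[of _ "\<lambda>k. N - k" "\<lambda>k. N - k"]) (auto simp: N)
  also have "\<dots> = (\<Sum>k = 0..m. - f k)"
    by (intro sum.cong refl assms(2)) (auto simp: N)
  finally show ?thesis by (simp add: sum_negf)
qed

text \<open>
  With \<open>A = a\<^sup>2 / q\<^sup>2\<close>, \<open>B = b / q\<^sup>2\<close>, \<open>C = c / q\<^sup>2\<close> and base \<open>q\<^sup>4\<close>, this is the left-hand side of the
  \<open>q\<close>-Dixon summation formula.
\<close>

lemma terminating_dixon_eq_0:
  fixes q a b c :: "'a :: field"
  assumes nz: "q \<noteq> 0" "b \<noteq> 0" "c \<noteq> 0"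
    and N: "odd N" "a\<^sup>2 * q powi (4 * int N - 2) = 1"
    and D: "q_pochhammer (a\<^sup>2 * q ^ 4 / b) (q ^ 4) N \<noteq> 0"
           "q_pochhammer (a\<^sup>2 * q ^ 4 / c) (q ^ 4) N \<noteq> 0"
           "q_pochhammer (q ^ 4) (q ^ 4) N \<noteq> 0"
  shows "(\<Sum>k = 0..N. ((1 + a * q powi (4 * int k - 1)) *
              (q_pochhammer (a\<^sup>2 / q\<^sup>2) (q ^ 4) k * q_pochhammer (b / q\<^sup>2) (q ^ 4) k *
               q_pochhammer (c / q\<^sup>2) (q ^ 4) k)) /
              (q_pochhammer (a\<^sup>2 * q ^ 4 / b) (q ^ 4) k * q_pochhammer (a\<^sup>2 * q ^ 4 / c) (q ^ 4) k *
               q_pochhammer (q ^ 4) (q ^ 4) k) *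
             (a * q ^ 7 / (b * c)) ^ k) = 0"
    (is "(\<Sum>k = 0..N. ?t k) = 0")
proof (rule sum_antisym_eq_0[OF N(1)])
  fix k l assume kl: "k + l = N"
  define w where "w = (\<lambda>k l. (1 + a * q powi (4 * int k - 1)) * (- (a ^ 3 * q)) ^ k
                        * (q ^ 12) ^ (k * l + \<Sum>{..<k}))"
  let ?P = "\<lambda>x. q_pochhammer x (q ^ 4)"
  define A B C where "A = a\<^sup>2 / q\<^sup>2" and "B = b / q\<^sup>2" and "C = c / q\<^sup>2"
  \<comment> \<open>That is, \<open>A = (q^4)^(-N)\<close>, which turns the well-poised relation
    \<open>x * y = A * q^4\<close> into the hypothesis of the reversal formula at length
    \<open>N\<close>.\<close>
  have AN: "A * (q ^ 4) ^ N = 1"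
  proof -
    have "(q ^ 4) ^ N = q powi (4 * int N)"
      using power_int_of_nat[of q "4 * N"] by (simp add: power_mult)
    then show ?thesis using N(2) nz by (simp add: A_def power_int_diff)
  qed
  have a0: "a \<noteq> 0" using N(2) by auto
  have ABC: "A \<noteq> 0" "B \<noteq> 0" "C \<noteq> 0" using nz a0 by (auto simp: A_def B_def C_def)
  \<comment> \<open>Applied to the pairs \<open>(A, q^4)\<close>, \<open>(B, a^2 q^4 / b)\<close>
    and \<open>(C, a^2 q^4 / c)\<close>. Reversal trades \<open>1 / (y)_i\<close> for
    \<open>(x)_j / (x)_N\<close> times a monomial, so the quotient becomes symmetric in
    \<open>i\<close> and \<open>j\<close> up to that monomial.\<close>
  have quot: "?P x i / ?P y i =
      ?P x i * ?P x j * (- x) ^ i * (q ^ 4) ^ (i * j + \<Sum>{..<i}) / ?P x N"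
    if "x \<noteq> 0" "x * y = A * q ^ 4" "?P y N \<noteq> 0" "i + j = N" for x y i j
  proof -
    have *: "x * y * (q ^ 4) ^ N = q ^ 4" using that(2) AN by (simp add: mult_ac)
    have rev: "?P x N = ?P x j * ?P y i * (- x) ^ i * (q ^ 4) ^ (i * j + \<Sum>{..<i})"
      using q_pochhammer_reverse[of "q ^ 4" x y i j] nz * that(4) by simp
    \<comment> \<open>Reversal over the full length (\<open>k = N\<close>, \<open>l = 0\<close>)
      makes \<open>(x)_N\<close> a nonzero multiple of \<open>(y)_N\<close>.\<close>
    have "?P x N \<noteq> 0"
      using q_pochhammer_reverse[of "q ^ 4" x y N 0] nz * that(1,3) by simp
    moreover have "?P y i \<noteq> 0" using q_pochhammer_neq_0_mono[OF that(3), of i] that(4) by simp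
    ultimately show ?thesis using rev by (simp add: divide_simps mult_ac)
  qed
  \<comment> \<open>\<open>s\<close> is symmetric in its two arguments; all the asymmetry of the
    summand sits in \<open>w\<close>.\<close>
  define s where "s = (\<lambda>i j. ?P A i * ?P A j * ?P B i * ?P B j * ?P C i * ?P C j
                               / (?P A N * ?P B N * ?P C N))"
  \<comment> \<open>A commutative rearrangement with the large factors abstracted to variables, so
    that one unification replaces sorting them.\<close>
  have regroup: "u * (x1 * y1 * z1 * E / d1) * (x2 * y2 * z2 * E / d2) * (x3 * y3 * z3 * E / d3) * v =
      x1 * y1 * x2 * y2 * x3 * y3 / (d1 * d2 * d3) * (u * (z1 * z2 * z3 * v) * (E * E * E))"
    for u v E x1 x2 x3 y1 y2 y3 z1 z2 z3 d1 d2 d3 :: 'a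
    by (simp add: mult_ac)
  have t: "?t i = s i j * w i j" if ij: "i + j = N" for i j
  proof -
    have "?t i = (1 + a * q powi (4 * int i - 1)) * (?P A i / ?P (q ^ 4) i) *
       (?P B i / ?P (a\<^sup>2 * q ^ 4 / b) i) * (?P C i / ?P (a\<^sup>2 * q ^ 4 / c) i) * (a * q ^ 7 / (b * c)) ^ i"
      by (simp add: A_def B_def C_def mult_ac)
    also have "\<dots> = (1 + a * q powi (4 * int i - 1)) *
       (?P A i * ?P A j * (- A) ^ i * (q ^ 4) ^ (i * j + \<Sum>{..<i}) / ?P A N) *
       (?P B i * ?P B j * (- B) ^ i * (q ^ 4) ^ (i * j + \<Sum>{..<i}) / ?P B N) *
       (?P C i * ?P C j * (- C) ^ i * (q ^ 4) ^ (i * j + \<Sum>{..<i}) / ?P C N) * (a * q ^ 7 / (b * c)) ^ i"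
      using nz by (subst (1 2 3) quot[OF _ _ _ ij])
        (use D ABC in \<open>simp_all add: A_def B_def C_def field_simps\<close>)
    also have "\<dots> = s i j * ((1 + a * q powi (4 * int i - 1)) *
        ((- A) * (- B) * (- C) * (a * q ^ 7 / (b * c))) ^ i *
        (q ^ 4 * q ^ 4 * q ^ 4) ^ (i * j + \<Sum>{..<i}))"
      unfolding s_def power_mult_distrib by (rule regroup)
    \<comment> \<open>The argument \<open>a q^7 / (b c)\<close> of the series is what makes
      \<open>b\<close> and \<open>c\<close> cancel here.\<close>
    also have "(- A) * (- B) * (- C) * (a * q ^ 7 / (b * c)) = - (a ^ 3 * q)"
      using nz by (simp add: A_def B_def C_def field_simps eval_nat_numeral)
    also have "q ^ 4 * q ^ 4 * q ^ 4 = q ^ 12" by (simp flip: power_add)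
    finally show ?thesis by (simp add: w_def)
  qed
  have "w l k = - w k l"
    unfolding w_def using well_poised_weight_antisym[of q a k l] nz N kl by simp
  moreover have "s l k = s k l" by (simp add: s_def mult_ac)
  ultimately show "?t l = - ?t k" using t[of k l] t[of l k] kl by simp
qed

section \<open>Ring homomorphisms and their partial extension to fractions\<close>

locale unital_hom =
  fixes h :: "'a :: comm_ring_1 \<Rightarrow> 'b :: comm_ring_1"
  assumes hom_add: "h (x + y) = h x + h y"
    and hom_mult: "h (x * y) = h x * h y"
    and hom_one: "h 1 = 1"
begin

lemma hom_zero: "h 0 = 0"
  using hom_add[of 0 0] by simp

lemma hom_uminus: "h (- x) = - h x"
  using hom_add[of x "- x"] by (simp add: hom_zero eq_neg_iff_add_eq_0 add.commute)

lemma hom_sum: "h (\<Sum>i\<in>I. f i) = (\<Sum>i\<in>I. h (f i))"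
  by (induction I rule: infinite_finite_induct) (simp_all add: hom_zero hom_add)

end

lemma unital_hom_map_poly:
  assumes "unital_hom h"
  shows "unital_hom (map_poly h)"
proof -
  interpret unital_hom h by fact
  show ?thesis
    by standard (simp_all add: poly_eq_iff coeff_map_poly coeff_mult
        hom_zero hom_add hom_mult hom_one hom_sum)
qed

lemma unital_hom_comp: "unital_hom g \<Longrightarrow> unital_hom h \<Longrightarrow> unital_hom (\<lambda>x. g (h x))"
  by (simp add: unital_hom_def)

lemma unital_hom_poly: "unital_hom (\<lambda>p. poly p x)"
  by (simp add: unital_hom_def)

lemma unital_hom_to_fract: "unital_hom (to_fract :: 'a :: idom \<Rightarrow> 'a fract)"
  by (simp add: unital_hom_def)

lemma unital_hom_of_int: "unital_hom of_int"
  by (simp add: unital_hom_def)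

text \<open>
  Reads \<open>y\<close> as the value at \<open>x\<close> of the partial extension of \<open>h\<close> to fractions, defined where some
  denominator of \<open>x\<close> is not killed by \<open>h\<close>.
\<close>

definition specializes :: "('a :: idom \<Rightarrow> 'b :: field) \<Rightarrow> 'a fract \<Rightarrow> 'b \<Rightarrow> bool" where
  "specializes h x y \<longleftrightarrow> (\<exists>X Y. x * to_fract Y = to_fract X \<and> h Y \<noteq> 0 \<and> y * h Y = h X)"

locale specialization = unital_hom h for h :: "'a :: idom \<Rightarrow> 'b :: field"
begin

lemma spec_to_fract: "h X = y \<Longrightarrow> specializes h (to_fract X) y"
  unfolding specializes_def by (intro exI[of _ X] exI[of _ 1]) (simp add: hom_one)

lemma spec_one: "specializes h 1 1"
  using spec_to_fract[of 1] by (simp add: hom_one)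

lemma spec_zero: "specializes h 0 0"
  using spec_to_fract[of 0] by (simp add: hom_zero)

lemma spec_add:
  assumes "specializes h x x'" "specializes h y y'"
  shows "specializes h (x + y) (x' + y')"
proof -
  obtain X Y U V where *: "x * to_fract Y = to_fract X" "h Y \<noteq> 0" "x' * h Y = h X"
      "y * to_fract V = to_fract U" "h V \<noteq> 0" "y' * h V = h U"
    using assms unfolding specializes_def by blast
  have "(x + y) * to_fract (Y * V) = to_fract (X * V + U * Y)"
    unfolding to_fract_add to_fract_mult *(1,4)[symmetric] by (simp add: algebra_simps)
  moreover have "(x' + y') * h (Y * V) = h (X * V + U * Y)"
    unfolding hom_add hom_mult *(3,6)[symmetric] by (simp add: algebra_simps)
  ultimately show ?thesis unfolding specializes_def using * hom_mult by (metis mult_eq_0_iff)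
qed

lemma spec_mult:
  assumes "specializes h x x'" "specializes h y y'"
  shows "specializes h (x * y) (x' * y')"
proof -
  obtain X Y U V where *: "x * to_fract Y = to_fract X" "h Y \<noteq> 0" "x' * h Y = h X"
      "y * to_fract V = to_fract U" "h V \<noteq> 0" "y' * h V = h U"
    using assms unfolding specializes_def by blast
  have "(x * y) * to_fract (Y * V) = to_fract (X * U)"
    unfolding to_fract_mult *(1,4)[symmetric] by (simp add: algebra_simps)
  moreover have "(x' * y') * h (Y * V) = h (X * U)"
    unfolding hom_mult *(3,6)[symmetric] by (simp add: algebra_simps)
  ultimately show ?thesis unfolding specializes_def using * hom_mult by (metis mult_eq_0_iff)
qed

lemma spec_uminus: "specializes h x x' \<Longrightarrow> specializes h (- x) (- x')"
  using spec_mult[OF spec_to_fract[OF refl, of "- 1"], of x x'] by (simp add: hom_uminus hom_one)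

lemma spec_diff:
  assumes "specializes h x x'" "specializes h y y'"
  shows "specializes h (x - y) (x' - y')"
  using spec_add[OF assms(1) spec_uminus[OF assms(2)]] by simp

lemma spec_inverse:
  assumes "specializes h x x'" "x' \<noteq> 0"
  shows "specializes h (inverse x) (inverse x')"
proof -
  obtain X Y where *: "x * to_fract Y = to_fract X" "h Y \<noteq> 0" "x' * h Y = h X"
    using assms unfolding specializes_def by blast
  then have "h X \<noteq> 0" using assms(2) by auto
  then have "X \<noteq> 0" using hom_zero by auto
  then have "x \<noteq> 0" using * by auto
  have "inverse x * to_fract X = to_fract Y"
    using \<open>x \<noteq> 0\<close> by (simp add: *(1)[symmetric])
  moreover have "inverse x' * h X = h Y" using assms(2) by (simp add: *(3)[symmetric])
  ultimately show ?thesis unfolding specializes_def using \<open>h X \<noteq> 0\<close> by blast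
qed

lemma spec_divide:
  assumes "specializes h x x'" "specializes h y y'" "y' \<noteq> 0"
  shows "specializes h (x / y) (x' / y')"
  using spec_mult[OF assms(1) spec_inverse[OF assms(2,3)]] by (simp add: divide_inverse)

lemma spec_power: "specializes h x x' \<Longrightarrow> specializes h (x ^ m) (x' ^ m)"
  by (induction m) (auto intro: spec_one spec_mult)

lemma spec_power_int:
  assumes "specializes h x x'" "x' \<noteq> 0"
  shows "specializes h (x powi i) (x' powi i)"
  unfolding power_int_def using assms by (auto intro!: spec_power spec_inverse)

lemma spec_sum:
  "(\<And>i. i \<in> I \<Longrightarrow> specializes h (f i) (g i)) \<Longrightarrow>
     specializes h (\<Sum>i\<in>I. f i) (\<Sum>i\<in>I. g i)"
  by (induction I rule: infinite_finite_induct) (auto intro: spec_zero spec_add)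

lemma spec_q_pochhammer:
  assumes "specializes h x x'" "specializes h p p'"
  shows "specializes h (q_pochhammer x p k) (q_pochhammer x' p' k)"
  by (induction k) (auto intro!: spec_one spec_mult spec_diff spec_power assms)

lemmas spec_intros = spec_one spec_add spec_mult spec_diff spec_divide spec_power
  spec_power_int spec_sum spec_q_pochhammer

end

text \<open>The bridge from evaluation to congruences. If \<open>X / Y\<close> represents
  \<open>x\<close> with \<open>h X = 0\<close> and \<open>h Y\<close> nonzero, and
  \<open>U / V\<close> is the reduced form, then \<open>U * Y = X * V\<close>; applying
  \<open>h\<close> gives \<open>h U * h Y = 0\<close>.\<close>

lemma numerator_specializes_0:
  fixes h :: "'a :: {ring_gcd, idom_divide, semiring_gcd_mult_normalize} \<Rightarrow> 'b :: field"
  assumes "unital_hom h" "specializes h x 0"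
  shows "h (fst (quot_of_fract x)) = 0"
proof -
  interpret unital_hom h by fact
  obtain X Y where *: "x * to_fract Y = to_fract X" "h Y \<noteq> 0" "h X = 0"
    using assms(2) unfolding specializes_def by auto
  let ?U = "fst (quot_of_fract x)" and ?V = "snd (quot_of_fract x)"
  have "x = to_fract ?U / to_fract ?V"
    by (metis Fract_conv_to_fract Fract_quot_of_fract)
  moreover have "to_fract ?V \<noteq> 0" by simp
  ultimately have "x * to_fract ?V = to_fract ?U" by (metis nonzero_eq_divide_eq)
  then have "to_fract (?U * Y) = to_fract (X * ?V)"
    unfolding to_fract_mult *(1)[symmetric] by (metis mult.assoc mult.commute)
  then have "h ?U * h Y = h X * h ?V" by (metis to_fract_eq_iff hom_mult)
  with * show ?thesis by simp
qed

section \<open>Divisibility from distinct roots, and its descent from complex to integer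
  polynomials\<close>

lemma prod_linear_dvd:
  fixes p :: "'a :: idom poly"
  assumes "finite A" "\<And>a. a \<in> A \<Longrightarrow> poly p a = 0"
  shows "(\<Prod>a\<in>A. [:- a, 1:]) dvd p"
  using assms
proof (induction A arbitrary: p rule: finite_induct)
  case empty
  then show ?case by simp
next
  case (insert x A)
  obtain r where r: "p = [:- x, 1:] * r"
    using insert.prems[of x] by (auto simp: poly_eq_0_iff_dvd elim: dvdE)
  \<comment> \<open>The factor split off for \<open>x\<close> is nonzero at every other root
    \<open>a\<close>, as \<open>x\<close> is not in \<open>A\<close>.\<close>
  have "poly r a = 0" if "a \<in> A" for a
    using insert.prems[of a] insert.hyps that unfolding r by auto
  then have "(\<Prod>a\<in>A. [:- a, 1:]) dvd r" by (rule insert.IH)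
  then show ?case using insert.hyps unfolding r by (simp del: mult_pCons_left)
qed

lemma dvd_if_map_poly_of_int_dvd:
  fixes P U :: "int poly"
  assumes "is_unit (lead_coeff P)"
    and "map_poly of_int P dvd (map_poly of_int U :: complex poly)"
  shows "P dvd U"
proof -
  let ?h = "map_poly of_int :: int poly \<Rightarrow> complex poly"
  interpret unital_hom ?h by (rule unital_hom_map_poly[OF unital_hom_of_int])
  have deg: "degree (?h p) = degree p" for p by (rule degree_map_poly) simp
  have "P \<noteq> 0" using assms(1) by auto
  obtain Q R where QR: "pseudo_divmod U P = (Q, R)" by fastforce
  define u where "u = lead_coeff P ^ (Suc (degree U) - degree P)"
  from pseudo_divmod[OF \<open>P \<noteq> 0\<close> QR]
  have eq: "[:u:] * U = P * Q + R" and R: "R = 0 \<or> degree R < degree P"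
    by (auto simp: u_def)
  have "?h R = ?h [:u:] * ?h U - ?h P * ?h Q"
    using eq by (metis add_diff_cancel_left' hom_add hom_mult)
  then have "?h P dvd ?h R" using assms(2) by simp
  have "R = 0"
  proof (rule ccontr)
    assume "R \<noteq> 0"
    then have "?h R \<noteq> 0" by (simp add: map_poly_eq_0_iff)
    with \<open>?h P dvd ?h R\<close> have "degree P \<le> degree R" by (metis deg dvd_imp_degree_le)
    with R \<open>R \<noteq> 0\<close> show False by simp
  qed
  then have "P dvd [:u:] * U" using eq by simp
  moreover have "is_unit u" unfolding u_def is_unit_power_iff using assms(1) by blast
  then have "is_unit [:u:]" by (simp only: is_unit_const_poly_iff)
  ultimately show ?thesis using dvd_mult_unit_iff' by blast
qed

section \<open>The congruence modulo \<open>1 - a^2 q^(2n)\<close>, by specializing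
  \<open>a\<close>\<close>

lemma to_fract_power: "to_fract (x ^ i) = to_fract x ^ i"
  by (induction i) simp_all

lemma pow_X_eq_1_iff: "([:0, 1:] :: 'a :: idom poly) ^ m = 1 \<longleftrightarrow> m = 0"
proof
  assume "([:0, 1:] :: 'a poly) ^ m = 1"
  then have "degree (([:0, 1:] :: 'a poly) ^ m) = 0" by simp
  then show "m = 0" by (simp add: degree_power_eq)
qed simp

text \<open>\<open>h\<close> evaluates \<open>a\<close> at a root \<open>x\<close> of the modulus
  over the fraction field of \<open>\<int>[q]\<close>. Keeping \<open>b\<close> and \<open>c\<close>
  indeterminate ensures that no denominator of the sum is killed.\<close>

lemma numerator_vanishes_parametric:
  fixes n :: nat and x :: "int poly fract"
  defines "Q \<equiv> to_fract [:0, 1:] :: int poly fract"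
  defines "h \<equiv> map_poly (map_poly (\<lambda>u. poly (map_poly to_fract u) x)) :: poly4 \<Rightarrow> int poly fract poly poly"
  assumes n: "[n = 1] (mod 4)" and x: "x\<^sup>2 * Q ^ (2 * n) = 1"
  shows "h (fst (quot_of_fract (let q = to_fract poly_q; a = to_fract poly_a; b = to_fract poly_b; c = to_fract poly_c in
          (\<Sum>k = 0..(n + 1) div 2.
             ((1 + a * q powi (4 * int k - 1)) *
              (q_pochhammer (a^2 / q^2) (q^4) k * q_pochhammer (b / q^2) (q^4) k *
               q_pochhammer (c / q^2) (q^4) k)) /
             ((1 + a * q powi (-1)) *
              (q_pochhammer (a^2 * q^4 / b) (q^4) k * q_pochhammer (a^2 * q^4 / c) (q^4) k *
               q_pochhammer (q^4) (q^4) k)) *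
             (a * q^7 / (b * c)) ^ k)))) = 0"
    (is "h (fst (quot_of_fract ?S)) = 0")
proof -
  define N where "N = (n + 1) div 2"
  have "n mod 4 = 1" using n by (simp add: cong_def)
  then obtain m where m: "n = 4 * m + 1" by (metis mult_div_mod_eq)
  then have N: "odd N" "n + 1 = 2 * N" by (simp_all add: N_def)
  \<comment> \<open>Specialization of fractions needs a field as target, so the values in
    \<open>b\<close> and \<open>c\<close> are embedded into fractions.\<close>
  define H where "H = (\<lambda>p. to_fract (h p))"
  have hom_h: "unital_hom h"
    unfolding h_def
    by (intro unital_hom_map_poly unital_hom_comp[OF unital_hom_poly] unital_hom_to_fract)
  have hom_H: "unital_hom H"
    unfolding H_def by (intro unital_hom_comp[OF unital_hom_to_fract] hom_h)
  then interpret specialization H unfolding specialization_def .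
  define q a b c where "q = to_fract [:[:Q:]:]" and "a = to_fract [:[:x:]:]"
    and "b = to_fract ([:[:0, 1:]:] :: int poly fract poly poly)"
    and "c = to_fract ([:0, 1:] :: int poly fract poly poly)"
  have spec: "specializes H (to_fract poly_q) q" "specializes H (to_fract poly_a) a"
    "specializes H (to_fract poly_b) b" "specializes H (to_fract poly_c) c"
    by (intro spec_to_fract;
        simp add: H_def h_def poly_q_def poly_a_def poly_b_def poly_c_def q_def a_def b_def c_def
          map_poly_pCons Q_def)+
  have Q0: "Q \<noteq> 0" by (simp add: Q_def)
  have Qpow: "Q ^ i = 1 \<longleftrightarrow> i = 0" for i
  proof -
    have "Q ^ i = to_fract (([:0, 1:] :: int poly) ^ i)" by (simp only: Q_def to_fract_power)
    then show ?thesis using pow_X_eq_1_iff[of i, where 'a = int] to_fract_eq_iff[of "([:0, 1:] :: int poly) ^ i" 1]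
      by (simp del: to_fract_eq_iff)
  qed
  have qpow: "q ^ i = to_fract [:[:Q ^ i:]:]" for i
  proof -
    have "[:[:Q:]:] ^ i = [:[:Q ^ i:]:]" by (induction i) (simp_all add: one_pCons)
    then show ?thesis unfolding q_def to_fract_power[symmetric] by simp
  qed
  have apow: "a\<^sup>2 = to_fract [:[:x\<^sup>2:]:]"
    unfolding a_def to_fract_power[symmetric] by (simp add: power2_eq_square)
  have nz: "q \<noteq> 0" "b \<noteq> 0" "c \<noteq> 0" using Q0 by (simp_all add: q_def b_def c_def)
  have qi: "q ^ i \<noteq> 1" if "i \<noteq> 0" for i
  proof
    assume "q ^ i = 1"
    then have "to_fract [:[:Q ^ i:]:] = to_fract [:[:1:]:]" unfolding qpow by (simp flip: one_pCons)
    then show False using Qpow that by simp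
  qed
  have denom_q: "1 - q ^ 4 * (q ^ 4) ^ i \<noteq> 0" for i
    using qi[of "4 + 4 * i"] by (simp add: power_add power_mult)
  \<comment> \<open>A vanishing factor would express the indeterminate \<open>b\<close> as an
    element free of \<open>b\<close>; likewise for \<open>c\<close> below.\<close>
  have denom_b: "1 - a\<^sup>2 * q ^ 4 / b * (q ^ 4) ^ i \<noteq> 0" for i
  proof
    assume "1 - a\<^sup>2 * q ^ 4 / b * (q ^ 4) ^ i = 0"
    then have "b = a\<^sup>2 * (q ^ 4 * (q ^ 4) ^ i)" using nz by (simp add: field_simps)
    then have "b = a\<^sup>2 * q ^ (4 + 4 * i)" by (simp only: power_add power_mult)
    then show False unfolding apow qpow b_def to_fract_mult[symmetric] to_fract_eq_iff by simp
  qed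
  have denom_c: "1 - a\<^sup>2 * q ^ 4 / c * (q ^ 4) ^ i \<noteq> 0" for i
  proof
    assume "1 - a\<^sup>2 * q ^ 4 / c * (q ^ 4) ^ i = 0"
    then have "c = a\<^sup>2 * (q ^ 4 * (q ^ 4) ^ i)" using nz by (simp add: field_simps)
    then have "c = a\<^sup>2 * q ^ (4 + 4 * i)" by (simp only: power_add power_mult)
    then show False unfolding apow qpow c_def to_fract_mult[symmetric] to_fract_eq_iff by simp
  qed
  have aq: "a\<^sup>2 * q ^ (2 * n) = 1"
    unfolding apow qpow to_fract_mult[symmetric] using x by (simp add: mult.commute flip: one_pCons)
  \<comment> \<open>Otherwise \<open>a = - q\<close>, and \<open>a^2 q^(2n) = 1\<close> would make
    \<open>q\<close> a root of unity.\<close>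
  have denom_a: "1 + a * q powi (-1) \<noteq> 0"
  proof
    assume "1 + a * q powi (-1) = 0"
    then have "a = - q" using nz by (simp add: field_simps eq_neg_iff_add_eq_0 add.commute)
    then have "q ^ (2 + 2 * n) = 1" using aq by (simp only: power_add power2_minus)
    with qi[of "2 + 2 * n"] show False by (metis add_is_0 zero_neq_numeral)
  qed
  have aN: "a\<^sup>2 * q powi (4 * int N - 2) = 1"
  proof -
    have "4 * int N - 2 = int (2 * n)" using N(2) by simp
    then show ?thesis using aq by (metis power_int_of_nat)
  qed
  have poch: "q_pochhammer (a^2 * q^4 / b) (q^4) k \<noteq> 0"
    "q_pochhammer (a^2 * q^4 / c) (q^4) k \<noteq> 0" "q_pochhammer (q^4) (q^4) k \<noteq> 0" for k
    using denom_q denom_b denom_c by (auto simp: q_pochhammer_def)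
  let ?r = "\<Sum>k = 0..N.
             ((1 + a * q powi (4 * int k - 1)) *
              (q_pochhammer (a^2 / q^2) (q^4) k * q_pochhammer (b / q^2) (q^4) k *
               q_pochhammer (c / q^2) (q^4) k)) /
             ((1 + a * q powi (-1)) *
              (q_pochhammer (a^2 * q^4 / b) (q^4) k * q_pochhammer (a^2 * q^4 / c) (q^4) k *
               q_pochhammer (q^4) (q^4) k)) *
             (a * q^7 / (b * c)) ^ k"
  have "specializes H ?S ?r"
    unfolding Let_def N_def[symmetric]
    by (intro spec_intros spec) (use nz poch denom_a in simp_all)
  moreover have "?r = 0"
  proof -
    \<comment> \<open>The constant \<open>1 + a/q\<close> is pulled out to leave the sum already
      shown to vanish.\<close>
    have "?r = (\<Sum>k = 0..N.
             ((1 + a * q powi (4 * int k - 1)) *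
              (q_pochhammer (a^2 / q^2) (q^4) k * q_pochhammer (b / q^2) (q^4) k *
               q_pochhammer (c / q^2) (q^4) k)) /
              (q_pochhammer (a^2 * q^4 / b) (q^4) k * q_pochhammer (a^2 * q^4 / c) (q^4) k *
               q_pochhammer (q^4) (q^4) k) *
             (a * q^7 / (b * c)) ^ k) / (1 + a * q powi (-1))"
      unfolding sum_divide_distrib by (intro sum.cong refl) (simp add: divide_simps)
    also have "\<dots> = 0"
      using terminating_dixon_eq_0[OF nz N(1) aN poch] by simp
    finally show ?thesis .
  qed
  ultimately have "H (fst (quot_of_fract ?S)) = 0"
    using numerator_specializes_0[OF hom_H] by simp
  then show ?thesis by (simp add: H_def)
qed

text \<open>Over the fraction field of \<open>\<int>[q]\<close> the quadratic in \<open>a\<close>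
  has the two distinct roots \<open>q^(-n)\<close> and \<open>- q^(-n)\<close>, so it divides there.
  Its constant coefficient 1 makes it primitive, and Gauss's lemma brings the divisibility back to
  \<open>\<int>[q][a]\<close>.\<close>

lemma quadratic_dvd_if_roots:
  fixes p :: "int poly poly"
  defines "Q \<equiv> to_fract [:0, 1:] :: int poly fract"
  assumes roots: "\<And>x. x\<^sup>2 * Q ^ (2 * n) = 1 \<Longrightarrow> poly (map_poly to_fract p) x = 0"
  shows "[:1, 0, - ([:0, 1:] ^ (2 * n)):] dvd p"
proof (rule fract_poly_dvdD)
  define x where "x = 1 / Q ^ n"
  have Q0: "Q ^ n \<noteq> 0" by (simp add: Q_def)
  have sq: "x\<^sup>2 * Q ^ (2 * n) = 1"
    using Q0 by (simp add: x_def power_divide power_mult [symmetric] mult.commute)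
  have "x \<noteq> - x"
  proof
    assume "x = - x"
    then have "2 * x = 0" by (metis add.right_inverse mult_2)
    moreover have "(2 :: int poly fract) \<noteq> 0"
      using to_fract_eq_iff[of 2 "0 :: int poly"] by (simp del: to_fract_eq_iff add: numeral_2_eq_2)
    ultimately show False using Q0 by (simp add: x_def)
  qed
  have "(\<Prod>y\<in>{x, - x}. [:- y, 1:]) dvd fract_poly p"
    by (rule prod_linear_dvd) (use sq in \<open>auto intro!: roots\<close>)
  moreover have "(\<Prod>y\<in>{x, - x}. [:- y, 1:]) = [:- (x\<^sup>2), 0, 1:]"
    using \<open>x \<noteq> - x\<close> by (simp add: power2_eq_square)
  moreover have "map_poly to_fract [:1, 0, - ([:0, 1:] ^ (2 * n)):] = smult (- (Q ^ (2 * n))) [:- (x\<^sup>2), 0, 1:]"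
  proof -
    have "to_fract (([:0, 1:] :: int poly) ^ i) = Q ^ i" for i
      unfolding Q_def by (rule to_fract_power)
    then show ?thesis using sq by (simp add: map_poly_pCons mult.commute)
  qed
  moreover have "- (Q ^ (2 * n)) \<noteq> 0" using Q0 by simp
  ultimately show "fract_poly [:1, 0, - ([:0, 1:] ^ (2 * n)):] dvd fract_poly p"
    by (metis smult_dvd)
  show "content [:1, 0, - ([:0, 1:] ^ (2 * n)) :: int poly:] = 1"
    by (simp add: content_def cCons_def)
qed

lemma ratfun_cong_parametric:
  fixes n :: nat
  assumes "[n = 1] (mod 4)"
  shows
    "(let q = to_fract poly_q; a = to_fract poly_a; b = to_fract poly_b; c = to_fract poly_c in
        ratfun_cong
          (\<Sum>k = 0..(n + 1) div 2.
             ((1 + a * q powi (4 * int k - 1)) *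
              (q_pochhammer (a^2 / q^2) (q^4) k * q_pochhammer (b / q^2) (q^4) k *
               q_pochhammer (c / q^2) (q^4) k)) /
             ((1 + a * q powi (-1)) *
              (q_pochhammer (a^2 * q^4 / b) (q^4) k * q_pochhammer (a^2 * q^4 / c) (q^4) k *
               q_pochhammer (q^4) (q^4) k)) *
             (a * q^7 / (b * c)) ^ k)
          0
          (1 - poly_a^2 * poly_q ^ (2 * n)))"
proof -
  let ?S = "let q = to_fract poly_q; a = to_fract poly_a; b = to_fract poly_b; c = to_fract poly_c in
          (\<Sum>k = 0..(n + 1) div 2.
             ((1 + a * q powi (4 * int k - 1)) *
              (q_pochhammer (a^2 / q^2) (q^4) k * q_pochhammer (b / q^2) (q^4) k *
               q_pochhammer (c / q^2) (q^4) k)) /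
             ((1 + a * q powi (-1)) *
              (q_pochhammer (a^2 * q^4 / b) (q^4) k * q_pochhammer (a^2 * q^4 / c) (q^4) k *
               q_pochhammer (q^4) (q^4) k)) *
             (a * q^7 / (b * c)) ^ k)"
  define U where "U = fst (quot_of_fract ?S)"
  define P :: "int poly poly" where "P = [:1, 0, - ([:0, 1:] ^ (2 * n)):]"
  \<comment> \<open>The modulus involves neither \<open>b\<close> nor \<open>c\<close>, so it
    suffices to divide each coefficient of the numerator with respect to \<open>c\<close> and
    \<open>b\<close>.\<close>
  have "P dvd coeff (coeff U i) j" for i j
    unfolding P_def
  proof (rule quadratic_dvd_if_roots)
    fix x :: "int poly fract"
    assume "x\<^sup>2 * to_fract [:0, 1:] ^ (2 * n) = 1"
    from numerator_vanishes_parametric[OF assms this, folded U_def]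
    have "coeff (coeff (map_poly (map_poly (\<lambda>u. poly (map_poly to_fract u) x)) U) i) j = 0"
      by simp
    then show "poly (map_poly to_fract (coeff (coeff U i) j)) x = 0"
      by (simp add: coeff_map_poly)
  qed
  then have "[:[:P:]:] dvd U" by (simp add: const_poly_dvd_iff)
  moreover have "1 - poly_a\<^sup>2 * poly_q ^ (2 * n) = [:[:P:]:]"
  proof -
    have "poly_q ^ i = [:[:[:[:0, 1:] ^ i:]:]:]" for i
      unfolding poly_q_def by (induction i) (simp_all add: one_pCons)
    then show ?thesis
      by (simp add: poly_a_def P_def power2_eq_square one_pCons)
  qed
  ultimately show ?thesis by (simp add: ratfun_cong_def U_def Let_def)
qed

section \<open>The congruence modulo the cyclotomic product, by evaluating \<open>q\<close> at roots
  of unity\<close>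

text \<open>The first condition on \<open>z\<close> is \<open>a^2 q^(2n) = 1\<close> at
  \<open>a = 1\<close>; the second keeps the denominators nonzero.\<close>

lemma numerator_vanishes_unity:
  fixes n :: nat and z :: complex
  assumes n: "n > 1" "[n = 1] (mod 4)"
    and z: "z ^ (2 * n) = 1" "\<And>i. 0 < i \<Longrightarrow> i < n \<Longrightarrow> z ^ (4 * i) \<noteq> 1"
  shows "poly (map_poly of_int (fst (quot_of_fract (let q = to_fract ([:0, 1:] :: int poly) in
          (\<Sum>k = 0..(n + 1) div 2.
             ((1 + q powi (4 * int k - 1)) * q_pochhammer (q powi (-2)) (q^4) k ^ 3) /
             ((1 + q) * q_pochhammer (q^4) (q^4) k ^ 3) *
             q ^ (7 * k)))))) z = 0"
    (is "poly (map_poly of_int (fst (quot_of_fract ?S))) z = 0")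
proof -
  define N where "N = (n + 1) div 2"
  have "n mod 4 = 1" using n by (simp add: cong_def)
  then obtain m where m: "n = 4 * m + 1" by (metis mult_div_mod_eq)
  then have N: "odd N" "n + 1 = 2 * N" by (simp_all add: N_def)
  \<comment> \<open>The factors of the denominators are \<open>1 - z^(4i)\<close> with
    \<open>1 \<le> i \<le> N\<close>, so this places them in the range covered by the second
    condition.\<close>
  then have "N < n" using n by simp
  define h where "h = (\<lambda>p :: int poly. poly (map_poly of_int p) z)"
  have hom_h: "unital_hom h"
    unfolding h_def
    by (intro unital_hom_map_poly unital_hom_comp[OF unital_hom_poly] unital_hom_of_int)
  then interpret specialization h unfolding specialization_def .
  have spec: "specializes h (to_fract [:0, 1:]) z"
    by (intro spec_to_fract) (simp add: h_def map_poly_pCons)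
  have z0: "z \<noteq> 0" using z(1) n by (auto simp: power_0_left)
  have poch: "q_pochhammer (z ^ 4) (z ^ 4) k \<noteq> 0" if "k \<le> N" for k
  proof -
    have "1 - z ^ 4 * (z ^ 4) ^ i \<noteq> 0" if "i < k" for i
      using z(2)[of "Suc i"] that \<open>k \<le> N\<close> \<open>N < n\<close> by (simp add: power_add power_mult)
    then show ?thesis by (simp add: q_pochhammer_def)
  qed
  have "z \<noteq> -1" using z(2)[of 1] n by auto
  then have z1: "1 + z \<noteq> 0" by (metis add_eq_0_iff)
  have zN: "1\<^sup>2 * z powi (4 * int N - 2) = 1"
  proof -
    have "4 * int N - 2 = int (2 * n)" using N(2) by simp
    then show ?thesis using z(1) by (metis power_int_of_nat mult_1 power_one)
  qed
  let ?r = "\<Sum>k = 0..N.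
             ((1 + z powi (4 * int k - 1)) * q_pochhammer (z powi (-2)) (z^4) k ^ 3) /
             ((1 + z) * q_pochhammer (z^4) (z^4) k ^ 3) *
             z ^ (7 * k)"
  have "specializes h ?S ?r"
    unfolding Let_def N_def[symmetric]
    by (intro spec_intros spec) (use z0 z1 poch in simp_all)
  moreover have "?r = 0"
  proof -
    \<comment> \<open>At \<open>a = b = c = 1\<close> all three numerator parameters become
      \<open>q^(-2)\<close>, all three denominator parameters \<open>q^4\<close>, and the argument
      \<open>q^7\<close>.\<close>
    have "z powi (-2) = 1 / z\<^sup>2" by (simp add: power_int_minus divide_inverse)
    moreover have "z ^ (7 * k) = (z ^ 7) ^ k" "z ^ (k * 7) = (z ^ 7) ^ k" for k
      by (simp_all add: power_mult mult.commute[of k])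
    ultimately have "?r = (\<Sum>k = 0..N.
             ((1 + 1 * z powi (4 * int k - 1)) *
              (q_pochhammer (1\<^sup>2 / z\<^sup>2) (z^4) k * q_pochhammer (1 / z^2) (z^4) k *
               q_pochhammer (1 / z^2) (z^4) k)) /
              (q_pochhammer (1\<^sup>2 * z^4 / 1) (z^4) k * q_pochhammer (1\<^sup>2 * z^4 / 1) (z^4) k *
               q_pochhammer (z^4) (z^4) k) *
             (1 * z^7 / (1 * 1)) ^ k) / (1 + z)"
      unfolding sum_divide_distrib
      by (intro sum.cong refl) (simp add: power3_eq_cube mult_ac)
    also have "\<dots> = 0"
      using terminating_dixon_eq_0[OF z0 _ _ N(1) zN, of 1 1] poch by simp
    finally show ?thesis .
  qed
  ultimately show ?thesis
    using numerator_specializes_0[OF hom_h] by (simp add: h_def)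
qed

text \<open>The exponent \<open>k * i\<close> matters only modulo \<open>n\<close>, and distinct
  residues give distinct roots of unity.\<close>

lemma cis_root_power_eq_1_iff:
  assumes "n > 0"
  shows "cis (2 * pi * real k / real n) ^ i = 1 \<longleftrightarrow> n dvd k * i"
proof -
  define f where "f j = cis (2 * pi * real j / real n)" for j
  have f_add: "f (i + j) = f i * f j" for i j
    by (simp add: f_def cis_mult add_divide_distrib algebra_simps)
  have f_mult: "f (n * j) = 1" for j
  proof -
    have "2 * pi * real (n * j) / real n = 2 * pi * real j" using assms by simp
    then show ?thesis by (simp only: f_def cis_multiple_2pi Ints_of_nat)
  qed
  have "cis (2 * pi * real k / real n) ^ i = f (k * i)"
    by (simp add: f_def DeMoivre algebra_simps)
  also have "\<dots> = f (n * (k * i div n) + k * i mod n)" by simp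
  also have "\<dots> = f (k * i mod n)" unfolding f_add f_mult by simp
  finally have "cis (2 * pi * real k / real n) ^ i = f (k * i mod n)" .
  moreover have "f (k * i mod n) = f 0 \<longleftrightarrow> k * i mod n = 0"
    using bij_betw_imp_inj_on[OF bij_betw_roots_unity[OF assms]] assms
    unfolding f_def by (subst inj_on_eq_iff) auto
  moreover have "f 0 = 1" by (simp add: f_def)
  ultimately show ?thesis by (simp add: mod_eq_0_iff_dvd)
qed

text \<open>The modulus has as roots the primitive \<open>n\<close>-th roots of unity and their
  negatives. For odd \<open>n\<close> these are all distinct, so the linear factors multiply to a
  divisor over the complex numbers; the leading coefficient is 1 or -1, so divisibility descends to
  the integers.\<close>

lemma cyclotomic_prod_dvd_if_roots:
  fixes U :: "int poly"
  assumes n: "n > 1" "odd n"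
    and roots: "\<And>z :: complex. z ^ (2 * n) = 1 \<Longrightarrow> (\<And>i. 0 < i \<Longrightarrow> i < n \<Longrightarrow> z ^ (4 * i) \<noteq> 1) \<Longrightarrow>
                  poly (map_poly of_int U) z = 0"
  shows "cyclotomic_poly n * pcompose (cyclotomic_poly n) [:0, -1:] dvd U"
proof (rule dvd_if_map_poly_of_int_dvd)
  let ?h = "map_poly of_int :: int poly \<Rightarrow> complex poly"
  interpret unital_hom ?h by (rule unital_hom_map_poly[OF unital_hom_of_int])
  define K where "K = {k\<in>{1..n}. coprime k n}"
  define f where "f k = cis (2 * pi * real k / real n)" for k
  have f_pow: "f k ^ i = 1 \<longleftrightarrow> n dvd k * i" for k i
    unfolding f_def using n by (intro cis_root_power_eq_1_iff) simp
  have finK: "finite K" by (simp add: K_def)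
  have inj: "inj_on f K"
  proof -
    \<comment> \<open>For \<open>n > 1\<close> the index \<open>n\<close> is not coprime to itself,
      so \<open>K\<close> lies where the roots are known to be enumerated injectively.\<close>
    have "K \<subseteq> {..<n}" using n by (auto simp: K_def le_less)
    then show ?thesis
      using bij_betw_imp_inj_on[OF bij_betw_roots_unity[of n]] n
      unfolding f_def by (auto intro: inj_on_subset)
  qed
  have root: "poly (?h U) z = 0" if "z = f k \<or> z = - f k" "k \<in> K" for z k
  proof (rule roots)
    show "z ^ (2 * n) = 1" using that(1) f_pow[of k "2 * n"] by auto
    fix i assume i: "0 < i" "i < n"
    \<comment> \<open>As \<open>n\<close> is coprime to both 4 and \<open>k\<close>,
      \<open>n dvd 4 * k * i\<close> would force \<open>n dvd i\<close>. The even exponent then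
      hides the sign of \<open>z\<close>.\<close>
    have "coprime n 4" using n(2) coprime_power_right_iff[of n 2 2] by simp
    then have "\<not> n dvd k * (4 * i)"
      using that(2) i by (auto simp: K_def coprime_dvd_mult_right_iff coprime_commute dvd_imp_le
          dest: dvd_imp_le)
    moreover have "even (4 * i)" by simp
    ultimately show "z ^ (4 * i) \<noteq> 1" using that(1) f_pow[of k "4 * i"] by auto
  qed
  \<comment> \<open>For odd \<open>n\<close>, the \<open>n\<close>-th power is 1 on the first set
    and -1 on the second.\<close>
  have disj: "f ` K \<inter> (\<lambda>k. - f k) ` K = {}"
  proof -
    have "f k \<noteq> - f l" for k l
    proof
      assume "f k = - f l"
      then have "f k ^ n = - (f l ^ n)" using n(2) by simp
      then show False using f_pow[of k n] f_pow[of l n] by simp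
    qed
    then show ?thesis by auto
  qed
  have "(\<Prod>z\<in>f ` K \<union> (\<lambda>k. - f k) ` K. [:- z, 1:]) dvd ?h U"
    by (rule prod_linear_dvd) (use finK root in auto)
  also have "(\<Prod>z\<in>f ` K \<union> (\<lambda>k. - f k) ` K. [:- z, 1:]) =
       (\<Prod>k\<in>K. [:- f k, 1:]) * (\<Prod>k\<in>K. [:f k, 1:])"
    using finK disj inj
    by (subst prod.union_disjoint) (simp_all add: prod.reindex inj_on_def)
  finally have dvd: "(\<Prod>k\<in>K. [:- f k, 1:]) * (\<Prod>k\<in>K. [:f k, 1:]) dvd ?h U" .
  have C: "?h (cyclotomic_poly n) = (\<Prod>k\<in>K. [:- f k, 1:])"
    by (simp add: of_int_cyclotomic_poly complex_cyclotomic_poly_def K_def f_def)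
  have h_pcompose: "?h (pcompose p r) = pcompose (?h p) (?h r)" for p r
    by (induction p) (simp_all add: pcompose_pCons map_poly_pCons hom_add hom_mult)
  \<comment> \<open>Substituting \<open>- q\<close> turns each factor into
    \<open>- (q + f k)\<close>, so the product changes by the unit
    \<open>(- 1) ^ card K\<close>.\<close>
  have "?h (pcompose (cyclotomic_poly n) [:0, -1:]) = (\<Prod>k\<in>K. [:- f k, -1:])"
    by (simp add: h_pcompose C map_poly_pCons pcompose_prod pcompose_pCons)
  also have "\<dots> = (\<Prod>k\<in>K. - [:f k, 1:])" by simp
  also have "\<dots> = (- 1) ^ card K * (\<Prod>k\<in>K. [:f k, 1:])"
    using prod_uminus[of "\<lambda>k. [:f k, 1:]" K] by simp
  finally have C': "?h (pcompose (cyclotomic_poly n) [:0, -1:]) = (- 1) ^ card K * (\<Prod>k\<in>K. [:f k, 1:])" .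
  have "(- 1 :: complex poly) ^ card K = 1 \<or> (- 1 :: complex poly) ^ card K = - 1"
    by (cases "even (card K)") simp_all
  then show "?h (cyclotomic_poly n * pcompose (cyclotomic_poly n) [:0, -1:]) dvd ?h U"
    using dvd by (auto simp: hom_mult C C')
  have deg: "degree (?h p) = degree p" for p by (rule degree_map_poly) simp
  have "of_int (lead_coeff (cyclotomic_poly n)) = lead_coeff (?h (cyclotomic_poly n))"
    by (simp add: deg coeff_map_poly)
  then have "lead_coeff (cyclotomic_poly n) = 1"
    by (simp add: of_int_cyclotomic_poly monic_complex_cyclotomic_poly)
  then show "is_unit (lead_coeff (cyclotomic_poly n * pcompose (cyclotomic_poly n) [:0, -1:]))"
    by (simp add: lead_coeff_mult lead_coeff_comp is_unit_power_iff)
qed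

theorem theorem10p1:
  fixes n :: nat
  assumes "n > 0" and "[n = 1] (mod 4)"
  shows
    "(let q = to_fract poly_q; a = to_fract poly_a; b = to_fract poly_b; c = to_fract poly_c in
        ratfun_cong
          (\<Sum>k = 0..(n + 1) div 2.
             ((1 + a * q powi (4 * int k - 1)) *
              (q_pochhammer (a^2 / q^2) (q^4) k * q_pochhammer (b / q^2) (q^4) k *
               q_pochhammer (c / q^2) (q^4) k)) /
             ((1 + a * q powi (-1)) *
              (q_pochhammer (a^2 * q^4 / b) (q^4) k * q_pochhammer (a^2 * q^4 / c) (q^4) k *
               q_pochhammer (q^4) (q^4) k)) *
             (a * q^7 / (b * c)) ^ k)
          0
          (1 - poly_a^2 * poly_q ^ (2 * n)))
     \<and>
     (n > 1 \<longrightarrow>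
       (let q = to_fract ([:0, 1:] :: int poly) in
        ratfun_cong
          (\<Sum>k = 0..(n + 1) div 2.
             ((1 + q powi (4 * int k - 1)) * q_pochhammer (q powi (-2)) (q^4) k ^ 3) /
             ((1 + q) * q_pochhammer (q^4) (q^4) k ^ 3) *
             q ^ (7 * k))
          0
          (cyclotomic_poly n * pcompose (cyclotomic_poly n) [:0, -1:])))"
proof (intro conjI impI)
  assume "n > 1"
  obtain m where "n = 4 * m + 1"
    using assms(2) by (metis cong_def mod_less mult_div_mod_eq one_less_numeral_iff semiring_norm(76))
  then have "odd n" by simp
  show "let q = to_fract ([:0, 1:] :: int poly) in
        ratfun_cong
          (\<Sum>k = 0..(n + 1) div 2.
             ((1 + q powi (4 * int k - 1)) * q_pochhammer (q powi (-2)) (q^4) k ^ 3) /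
             ((1 + q) * q_pochhammer (q^4) (q^4) k ^ 3) *
             q ^ (7 * k))
          0
          (cyclotomic_poly n * pcompose (cyclotomic_poly n) [:0, -1:])"
    using cyclotomic_prod_dvd_if_roots[OF \<open>n > 1\<close> \<open>odd n\<close>
        numerator_vanishes_unity[OF \<open>n > 1\<close> assms(2)]]
    by (simp add: ratfun_cong_def Let_def)
qed (use ratfun_cong_parametric[OF assms(2)] in simp)

end
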